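(* Let $(E_1,\eta_1)\in\mathcal{A}$ be arbitrary. Then there exists $(E,\eta)\in\mathcal{A}_0$ such that $(E,\eta)\leq(E_1,\eta_1)$ in $\mathcal{A}$.
   Context: $\mathbb{Z}^+=\{1,2,3,\dots\}$. An admissible function of angles is a pair $(E,\eta)$ with $E\subset(0,\pi)$ a set and $\eta:E\to\mathbb{Z}^+$ a function such that for every $k\in\mathbb{Z}^+$ there exists $\theta\in E$ with $\sin(k\theta)\neq0$ and $k\geq\eta(\theta)$. $\mathcal{A}$ denotes the set of all admissible functions of angles, partially ordered by: $(E_1,\eta_1)\leq(E_2,\eta_2)$ if $E_1\subset E_2$ and $\eta_1(\theta)\geq\eta_2(\theta)$ for all $\theta\in E_1$. For $\theta\in\mathbb{R}$ the set $\mathcal{I}(\theta)=\{m\in\mathbb{Z}:\sin(m\theta)=0\}$ is an ideal in $\mathbb{Z}$, and $d(\theta)\geq0$ denotes its unique non-negative generator: $\mathcal{I}(\theta)=d(\theta)\mathbb{Z}$. $\operatorname{lcm}$ denotes the (non-negative) least common multiple. $\mathcal{A}_0\subset\mathcal{A}$ is the subset of those $(E,\eta)$ that arise from one of the following two constructions (both of which yield admissible functions of angles): (i) Infinite case: $\{\theta_k\}_{k=1}^\infty$ is an infinite sequence of rational multiples of $\pi$ in $(0,\pi)$ with $d(\theta_k)\nmid\operatorname{lcm}(d(\theta_1),\dots,d(\theta_{k-1}))$ for all $k\geq2$; $E=\{\theta_k:k\geq1\}$, $\eta(\theta_1)=1$ and $\eta(\theta_k)=\operatorname{lcm}(d(\theta_1),\dots,d(\theta_{k-1}))$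 for $k\geq2$. (ii) Finite case: $n\in\{0,1,2,\dots\}$, $\{\theta_k\}_{k=1}^n$ is a finite (possibly empty) sequence of rational multiples of $\pi$ in $(0,\pi)$ with $d(\theta_k)\nmid\operatorname{lcm}(d(\theta_1),\dots,d(\theta_{k-1}))$ for $2\leq k\leq n$, and $\theta_{n+1}\in(0,\pi)$ is an irrational multiple of $\pi$; $E=\{\theta_k:1\leq k\leq n+1\}$, $\eta(\theta_1)=1$ and $\eta(\theta_k)=\operatorname{lcm}(d(\theta_1),\dots,d(\theta_{k-1}))$ for $2\leq k\leq n+1$. *)

theory Defs
  imports "HOL-Analysis.Analysis" "HOL-Library.FuncSet"
begin

(* The extensional function space makes eta a function on E only, so that pairs (E, eta) are
   equal exactly when they agree as sets and functions; antisymmetry of the order needs this. *)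
definition admissible_angle_functions :: "(real set \<times> (real \<Rightarrow> nat)) set" where
  "admissible_angle_functions =
     {(E, \<eta>). E \<subseteq> {0<..<pi} \<and> \<eta> \<in> E \<rightarrow>\<^sub>E {1..} \<and>
        (\<forall>k\<ge>1. \<exists>\<theta>\<in>E. sin (real k * \<theta>) \<noteq> 0 \<and> k \<ge> \<eta> \<theta>)}"

definition angle_le ::
  "real set \<times> (real \<Rightarrow> nat) \<Rightarrow> real set \<times> (real \<Rightarrow> nat) \<Rightarrow> bool" where
  "angle_le = (\<lambda>(E1, \<eta>1) (E2, \<eta>2). E1 \<subseteq> E2 \<and> (\<forall>\<theta>\<in>E1. \<eta>1 \<theta> \<ge> \<eta>2 \<theta>))"

lemma partial_order_on_angle_le:
  "partial_order_on admissible_angle_functions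
     {(p, q). p \<in> admissible_angle_functions \<and> q \<in> admissible_angle_functions \<and> angle_le p q}"
proof -
  have "p = q"
    if "p \<in> admissible_angle_functions" "q \<in> admissible_angle_functions"
       "angle_le p q" "angle_le q p" for p q
  proof (cases p, cases q)
    fix E1 \<eta>1 E2 \<eta>2
    assume pq: "p = (E1, \<eta>1)" "q = (E2, \<eta>2)"
    have eq: "\<eta>1 \<theta> = \<eta>2 \<theta>" if "\<theta> \<in> E1" for \<theta>
      using \<open>angle_le p q\<close> \<open>angle_le q p\<close> that unfolding pq angle_le_def
      by (simp add: order_antisym subset_iff)
    have E: "E1 = E2"
      using \<open>angle_le p q\<close> \<open>angle_le q p\<close> unfolding pq angle_le_def by auto
    have "\<eta>1 \<in> E1 \<rightarrow>\<^sub>E {1..}" "\<eta>2 \<in> E1 \<rightarrow>\<^sub>E {1..}"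
      using that(1,2) unfolding pq E admissible_angle_functions_def by simp_all
    then have "\<eta>1 = \<eta>2" using eq by (rule PiE_ext)
    then show "p = q" using E pq by simp
  qed
  moreover have "angle_le p r" if "angle_le p q" "angle_le q r" for p q r
    using that unfolding angle_le_def
    by (cases p; cases q; cases r) (simp, meson order_trans subset_iff)
  moreover have "angle_le p p" for p
    by (cases p) (simp add: angle_le_def)
  ultimately show ?thesis
    unfolding partial_order_on_def preorder_on_def
    by (intro conjI refl_onI antisymI transI) (simp_all, blast+)
qed

definition sine_ideal :: "real \<Rightarrow> int set" where
  "sine_ideal \<theta> = {m. sin (of_int m * \<theta>) = 0}"

definition sine_gen :: "real \<Rightarrow> nat" where
  "sine_gen \<theta> = (THE d. sine_ideal \<theta> = range (\<lambda>j. int d * j))"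

lemma sine_ideal_closed:
  assumes "a \<in> sine_ideal \<theta>" "b \<in> sine_ideal \<theta>"
  shows "a - j * b \<in> sine_ideal \<theta>"
proof -
  obtain p q :: int where "of_int a * \<theta> = of_int p * pi" "of_int b * \<theta> = of_int q * pi"
    using assms unfolding sine_ideal_def by (auto simp: sin_zero_iff_int2)
  then have "of_int (a - j * b) * \<theta> = of_int (p - j * q) * pi"
    by (simp add: algebra_simps)
  then show ?thesis
    unfolding sine_ideal_def mem_Collect_eq sin_zero_iff_int2 by blast
qed

lemma sine_ideal_eq: "sine_ideal \<theta> = range (\<lambda>j. int (sine_gen \<theta>) * j)"
  unfolding sine_gen_def
proof (rule theI')
  have 0: "0 \<in> sine_ideal \<theta>"
    by (simp add: sine_ideal_def)
  have "\<exists>d. sine_ideal \<theta> = range (\<lambda>j. int d * j)"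
  proof (cases "sine_ideal \<theta> \<subseteq> {0}")
    case True
    then have "sine_ideal \<theta> = range (\<lambda>j. int 0 * j)" using 0 by auto
    then show ?thesis by blast
  next
    case False
    then obtain m where m: "m \<in> sine_ideal \<theta>" "m \<noteq> 0" by blast
    have neg: "- x \<in> sine_ideal \<theta>" if "x \<in> sine_ideal \<theta>" for x
      using sine_ideal_closed[OF 0 that, of 1] by simp
    define d where "d = (LEAST n. n > 0 \<and> int n \<in> sine_ideal \<theta>)"
    have "nat \<bar>m\<bar> > 0 \<and> int (nat \<bar>m\<bar>) \<in> sine_ideal \<theta>"
      using m neg by (auto simp: abs_if)
    then have "d > 0 \<and> int d \<in> sine_ideal \<theta>"
      unfolding d_def by (rule LeastI)
    then have d: "d > 0" "int d \<in> sine_ideal \<theta>" by simp_all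
    have le: "d \<le> n" if "n > 0" "int n \<in> sine_ideal \<theta>" for n
      unfolding d_def using that by (intro Least_le conjI)
    have "x \<in> range (\<lambda>j. int d * j)" if x: "x \<in> sine_ideal \<theta>" for x
    proof -
      define r where "r = x mod int d"
      have x_eq: "x = int d * (x div int d) + r"
        unfolding r_def by (rule mult_div_mod_eq[symmetric])
      have "0 \<le> r" "r < int d"
        unfolding r_def using d(1) by simp_all
      have "r = x - (x div int d) * int d"
        unfolding r_def by (rule minus_div_mult_eq_mod[symmetric])
      then have "r \<in> sine_ideal \<theta>"
        using sine_ideal_closed[OF x d(2)] by metis
      then have "\<not> 0 < nat r"
        using le[of "nat r"] \<open>0 \<le> r\<close> \<open>r < int d\<close> by fastforce
      then have "x = int d * (x div int d)"
        using x_eq \<open>0 \<le> r\<close> by linarith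
      then show ?thesis by (rule range_eqI)
    qed
    moreover have "int d * j \<in> sine_ideal \<theta>" for j
      using sine_ideal_closed[OF 0 d(2), of "- j"] by (simp add: mult.commute)
    ultimately have "sine_ideal \<theta> = range (\<lambda>j. int d * j)"
      by (intro subset_antisym subsetI) auto
    then show ?thesis by blast
  qed
  moreover have "d = e"
    if "range (\<lambda>j. int d * j) = range (\<lambda>j. int e * j)" for d e
  proof -
    have "int d * 1 \<in> range (\<lambda>j. int e * j)" "int e * 1 \<in> range (\<lambda>j. int d * j)"
      using that by (metis rangeI)+
    then have "int e dvd int d" "int d dvd int e"
      by (metis dvd_triv_left mult.right_neutral rangeE)+
    then show ?thesis by (simp add: dvd_antisym)
  qed
  ultimately show "\<exists>!d. sine_ideal \<theta> = range (\<lambda>j. int d * j)"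
    by (auto intro!: ex_ex1I)
qed

(* Sequences are indexed from 1; the value at 0 is never used. *)

definition infinite_construction :: "real set \<Rightarrow> (real \<Rightarrow> nat) \<Rightarrow> bool" where
  "infinite_construction E \<eta> \<longleftrightarrow>
     (\<exists>\<theta> :: nat \<Rightarrow> real.
        (\<forall>k\<ge>1. \<theta> k \<in> {0<..<pi} \<and> (\<exists>r\<in>\<rat>. \<theta> k = r * pi)) \<and>
        (\<forall>k\<ge>2. \<not> sine_gen (\<theta> k) dvd (LCM i\<in>{1..<k}. sine_gen (\<theta> i))) \<and>
        E = \<theta> ` {1..} \<and>
        \<eta> (\<theta> 1) = 1 \<and>
        (\<forall>k\<ge>2. \<eta> (\<theta> k) = (LCM i\<in>{1..<k}. sine_gen (\<theta> i))))"

definition finite_construction :: "real set \<Rightarrow> (real \<Rightarrow> nat) \<Rightarrow> bool" where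
  "finite_construction E \<eta> \<longleftrightarrow>
     (\<exists>(n :: nat) (\<theta> :: nat \<Rightarrow> real).
        (\<forall>k\<in>{1..n}. \<theta> k \<in> {0<..<pi} \<and> (\<exists>r\<in>\<rat>. \<theta> k = r * pi)) \<and>
        (\<forall>k\<in>{2..n}. \<not> sine_gen (\<theta> k) dvd (LCM i\<in>{1..<k}. sine_gen (\<theta> i))) \<and>
        \<theta> (n + 1) \<in> {0<..<pi} \<and> \<not> (\<exists>r\<in>\<rat>. \<theta> (n + 1) = r * pi) \<and>
        E = \<theta> ` {1..n + 1} \<and>
        \<eta> (\<theta> 1) = 1 \<and>
        (\<forall>k\<in>{2..n + 1}. \<eta> (\<theta> k) = (LCM i\<in>{1..<k}. sine_gen (\<theta> i))))"

definition basic_angle_functions :: "(real set \<times> (real \<Rightarrow> nat)) set" where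
  "basic_angle_functions =
     {(E, \<eta>) \<in> admissible_angle_functions. infinite_construction E \<eta> \<or> finite_construction E \<eta>}"

end

theory Submission
  imports Defs
begin

text \<open>
  The angles are chosen greedily. Let \<open>L\<close> be the least common multiple of the generators of the
  angles chosen so far. Admissibility of the given pair at \<open>L\<close> yields an angle \<open>\<theta>\<close> of the given
  set with \<open>sin (L * \<theta>) \<noteq> 0\<close>, so that its generator does not divide \<open>L\<close>, and whose value is at
  most \<open>L\<close>. The process stops at the first irrational multiple of \<open>\<pi>\<close>, and otherwise continues
  forever. If the resulting pair failed to be admissible at some \<open>m\<close>, then, inductively, every
  such \<open>L\<close> would divide \<open>m\<close>; but these numbers grow strictly, or end with 0.
\<close>

section \<open>Zeros of the sine as divisibility by the generator\<close>

lemma sin_of_nat_mult_eq_0_iff: "sin (real m * \<theta>) = 0 \<longleftrightarrow> sine_gen \<theta> dvd m"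
proof -
  have "sin (real m * \<theta>) = 0 \<longleftrightarrow> int m \<in> sine_ideal \<theta>"
    by (simp add: sine_ideal_def)
  also have "\<dots> \<longleftrightarrow> int (sine_gen \<theta>) dvd int m"
    unfolding sine_ideal_eq dvd_def by auto
  finally show ?thesis by simp
qed

text \<open>A denominator of a rational \<open>r\<close> is a nonzero element of the ideal of
  \<open>r * pi\<close>; conversely, dividing a zero condition by a nonzero generator exhibits such
  an \<open>r\<close>. Irrational angles thus show up as a factor 0 in the lcm.\<close>

lemma sine_gen_eq_0_iff: "sine_gen \<theta> = 0 \<longleftrightarrow> \<not> (\<exists>r\<in>\<rat>. \<theta> = r * pi)"
proof
  assume 0: "sine_gen \<theta> = 0"
  show "\<not> (\<exists>r\<in>\<rat>. \<theta> = r * pi)"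
  proof
    assume "\<exists>r\<in>\<rat>. \<theta> = r * pi"
    then obtain a b :: int where ab: "b > 0" "\<theta> = of_int a / of_int b * pi"
      by (metis Rats_cases')
    then have "of_int b * \<theta> = of_int a * pi" by simp
    then have "b \<in> sine_ideal \<theta>"
      unfolding sine_ideal_def mem_Collect_eq sin_zero_iff_int2 by blast
    then show False using 0 ab(1) unfolding sine_ideal_eq by auto
  qed
next
  assume irr: "\<not> (\<exists>r\<in>\<rat>. \<theta> = r * pi)"
  show "sine_gen \<theta> = 0"
  proof (rule ccontr)
    assume ne: "sine_gen \<theta> \<noteq> 0"
    have "sin (real (sine_gen \<theta>) * \<theta>) = 0"
      by (simp add: sin_of_nat_mult_eq_0_iff)
    then obtain p :: int where "real (sine_gen \<theta>) * \<theta> = of_int p * pi"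
      unfolding sin_zero_iff_int2 by blast
    then have "\<theta> = (of_int p / real (sine_gen \<theta>)) * pi"
      using ne by (simp add: field_simps)
    moreover have "of_int p / real (sine_gen \<theta>) \<in> \<rat>" by simp
    ultimately show False using irr by blast
  qed
qed

section \<open>Least common multiples of the preceding generators\<close>

definition previous_lcm :: "(nat \<Rightarrow> real) \<Rightarrow> nat \<Rightarrow> nat" where
  "previous_lcm \<theta> k = (LCM i\<in>{1..<k}. sine_gen (\<theta> i))"

text \<open>The lcm of the empty family is the value prescribed at the first angle, so one formula
  serves every index from 1 on.\<close>

lemma previous_lcm_1 [simp]: "previous_lcm \<theta> (Suc 0) = 1"
  by (simp add: previous_lcm_def)

lemma previous_lcm_Suc:
  "k \<ge> 1 \<Longrightarrow> previous_lcm \<theta> (Suc k) = lcm (sine_gen (\<theta> k)) (previous_lcm \<theta> k)"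
  by (simp add: previous_lcm_def atLeastLessThanSuc)

lemma sine_gen_dvd_previous_lcm: "1 \<le> i \<Longrightarrow> i < k \<Longrightarrow> sine_gen (\<theta> i) dvd previous_lcm \<theta> k"
  unfolding previous_lcm_def by (rule dvd_Lcm) auto

lemma previous_lcm_pos:
  assumes "\<And>i. 1 \<le> i \<Longrightarrow> i < k \<Longrightarrow> \<exists>r\<in>\<rat>. \<theta> i = r * pi"
  shows "previous_lcm \<theta> k \<ge> 1"
proof -
  have "sine_gen (\<theta> i) \<noteq> 0" if "i \<in> {1..<k}" for i
    using assms that unfolding sine_gen_eq_0_iff by auto
  then have "0 \<notin> (\<lambda>i. sine_gen (\<theta> i)) ` {1..<k}"
    by (metis (no_types, lifting) imageE)
  then have "previous_lcm \<theta> k \<noteq> 0"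
    unfolding previous_lcm_def by (subst Lcm_0_iff) simp_all
  then show ?thesis by simp
qed

text \<open>Each new generator fails to divide the current lcm, so the next lcm is a proper
  multiple. Rationality keeps it nonzero, and a proper nonzero multiple is strictly larger.\<close>

lemma previous_lcm_ge:
  assumes "\<And>k. k \<ge> 1 \<Longrightarrow> \<exists>r\<in>\<rat>. \<theta> k = r * pi"
    and "\<And>k. k \<ge> 1 \<Longrightarrow> \<not> sine_gen (\<theta> k) dvd previous_lcm \<theta> k"
  shows "previous_lcm \<theta> (Suc k) \<ge> Suc k"
proof (induction k)
  case 0
  then show ?case by simp
next
  case (Suc k)
  let ?L = "previous_lcm \<theta>"
  have eq: "?L (Suc (Suc k)) = lcm (sine_gen (\<theta> (Suc k))) (?L (Suc k))"
    by (simp add: previous_lcm_Suc)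
  have "?L (Suc k) dvd ?L (Suc (Suc k))"
    unfolding eq by (rule dvd_lcm2)
  moreover have "?L (Suc (Suc k)) \<noteq> ?L (Suc k)"
  proof
    assume "?L (Suc (Suc k)) = ?L (Suc k)"
    then have "sine_gen (\<theta> (Suc k)) dvd ?L (Suc k)"
      unfolding eq by (metis dvd_lcm1)
    then show False using assms(2)[of "Suc k"] by simp
  qed
  moreover have "?L (Suc (Suc k)) \<ge> 1"
    by (rule previous_lcm_pos) (use assms(1) in blast)
  ultimately have "?L (Suc k) < ?L (Suc (Suc k))"
    by (metis dvd_imp_le le_neq_implies_less less_le_trans zero_less_one)
  then show ?case using Suc by simp
qed

section \<open>The greedy choice and its admissibility\<close>

lemma greedy_sequence_exists:
  assumes "\<And>k::nat. k \<ge> 1 \<Longrightarrow> \<exists>\<theta>::real. P k \<theta>"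
  obtains \<theta> where "\<And>k. previous_lcm \<theta> k \<ge> 1 \<Longrightarrow> k \<ge> 1 \<Longrightarrow> P (previous_lcm \<theta> k) (\<theta> k)"
proof -
  \<comment> \<open>For \<open>L = 0\<close> the pick is arbitrary: the sequence runs on after the
    lcm has become 0, but nothing is claimed about it there.\<close>
  define pick where "pick L = (SOME \<theta>. P L \<theta>)" for L
  have pick: "P L (pick L)" if "L \<ge> 1" for L
    unfolding pick_def using assms[OF that] by (rule someI_ex)
  \<comment> \<open>Earlier choices matter only through their lcm, so the recursion carries just
    that number. \<open>M k\<close> covers the first \<open>k\<close> generators, whence the shift
    by one in \<open>\<theta>\<close>.\<close>
  define M :: "nat \<Rightarrow> nat" where "M = rec_nat 1 (\<lambda>_ L. lcm (sine_gen (pick L)) L)"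
  define \<theta> where "\<theta> k = pick (M (k - 1))" for k
  have M: "previous_lcm \<theta> (Suc k) = M k" for k
    by (induction k) (simp_all add: previous_lcm_Suc \<theta>_def M_def)
  have "P (previous_lcm \<theta> k) (\<theta> k)" if "previous_lcm \<theta> k \<ge> 1" "k \<ge> 1" for k
    using that pick M[of "k - 1"] by (simp add: \<theta>_def)
  then show thesis by (rule that)
qed

text \<open>The index set \<open>K\<close> is an initial segment of the positive integers, so that
  the infinite and the finite construction are treated together. Only \<open>unbounded\<close> has a
  different reason in the two cases.\<close>

lemma greedy_admissible:
  fixes \<theta> :: "nat \<Rightarrow> real" and K :: "nat set"
  assumes K: "0 \<notin> K" "\<And>i k. k \<in> K \<Longrightarrow> 1 \<le> i \<Longrightarrow> i < k \<Longrightarrow> i \<in> K"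
    and range: "\<And>k. k \<in> K \<Longrightarrow> \<theta> k \<in> {0<..<pi}"
    and pos: "\<And>k. k \<in> K \<Longrightarrow> previous_lcm \<theta> k \<ge> 1"
    and ndvd: "\<And>k. k \<in> K \<Longrightarrow> \<not> sine_gen (\<theta> k) dvd previous_lcm \<theta> k"
    and unbounded: "\<And>m. m \<ge> 1 \<Longrightarrow> \<exists>k\<in>K. \<not> previous_lcm \<theta> (Suc k) dvd m"
  obtains \<eta> where "(\<theta> ` K, \<eta>) \<in> admissible_angle_functions"
    and "\<And>k. k \<in> K \<Longrightarrow> \<eta> (\<theta> k) = previous_lcm \<theta> k"
proof -
  define \<eta> where
    "\<eta> = restrict (\<lambda>t. previous_lcm \<theta> (the_inv_into K \<theta> t)) (\<theta> ` K)"
  \<comment> \<open>The generator of the earlier angle divides the lcm at \<open>k\<close>, that of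
    \<open>\<theta> k\<close> does not. Injectivity makes the passage from angles back to indices in
    \<open>\<eta>\<close> legitimate.\<close>
  have ne: "\<theta> i \<noteq> \<theta> k" if "i \<in> K" "k \<in> K" "i < k" for i k
  proof -
    have "i \<ge> 1" using K(1) that(1) by (cases i) auto
    then show ?thesis using ndvd sine_gen_dvd_previous_lcm that by metis
  qed
  have inj: "inj_on \<theta> K"
    by (rule inj_onI) (metis ne linorder_neqE_nat)
  have \<eta>: "\<eta> (\<theta> k) = previous_lcm \<theta> k" if "k \<in> K" for k
    using that inj by (simp add: \<eta>_def the_inv_into_f_f)
  have ext: "\<eta> \<in> \<theta> ` K \<rightarrow>\<^sub>E {1..}"
  proof (rule PiE_I)
    show "\<eta> t \<in> {1..}" if "t \<in> \<theta> ` K" for t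
      using that \<eta> pos by auto
    show "\<eta> t = undefined" if "t \<notin> \<theta> ` K" for t
      using that by (simp add: \<eta>_def)
  qed
  have "\<exists>k\<in>K. sin (real m * \<theta> k) \<noteq> 0 \<and> m \<ge> previous_lcm \<theta> k" if m: "m \<ge> 1" for m
  proof (rule ccontr)
    assume "\<not> ?thesis"
    then have gen: "sine_gen (\<theta> k) dvd m" if "k \<in> K" "previous_lcm \<theta> k \<le> m" for k
      using that sin_of_nat_mult_eq_0_iff by blast
    \<comment> \<open>An lcm that divides the positive number \<open>m\<close> is at most
      \<open>m\<close>, so \<open>gen\<close> applies to the next angle; its generator then divides
      \<open>m\<close> too, and so does the enlarged lcm.\<close>
    have dvd: "Suc k \<in> K \<Longrightarrow> previous_lcm \<theta> (Suc (Suc k)) dvd m" for k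
    proof (induction k)
      case 0
      then show ?case using gen[of 1] m by (simp add: previous_lcm_Suc)
    next
      case (Suc k)
      have "Suc k \<in> K" using K(2)[OF Suc.prems] by simp
      then have *: "previous_lcm \<theta> (Suc (Suc k)) dvd m" using Suc.IH by simp
      then have "sine_gen (\<theta> (Suc (Suc k))) dvd m"
        using gen Suc.prems m by (simp add: dvd_imp_le)
      then show ?case using * by (simp add: previous_lcm_Suc[of "Suc (Suc k)"])
    qed
    obtain k where "k \<in> K" "\<not> previous_lcm \<theta> (Suc k) dvd m"
      using unbounded[OF m] by blast
    then show False using dvd K(1) by (cases k) auto
  qed
  then have "(\<theta> ` K, \<eta>) \<in> admissible_angle_functions"
    unfolding admissible_angle_functions_def using range ext \<eta> by fastforce
  then show thesis using \<eta> that by blast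
qed

section \<open>Construction of a basic pair below the given one\<close>

theorem theorem9p3:
  assumes "(E\<^sub>1, \<eta>\<^sub>1) \<in> admissible_angle_functions"
  shows "\<exists>(E, \<eta>) \<in> basic_angle_functions. angle_le (E, \<eta>) (E\<^sub>1, \<eta>\<^sub>1)"
proof -
  have E1: "E\<^sub>1 \<subseteq> {0<..<pi}"
    and "\<And>k. k \<ge> 1 \<Longrightarrow> \<exists>\<theta>. \<theta> \<in> E\<^sub>1 \<and> \<not> sine_gen \<theta> dvd k \<and> \<eta>\<^sub>1 \<theta> \<le> k"
    using assms unfolding admissible_angle_functions_def
    by (auto simp: sin_of_nat_mult_eq_0_iff)
  from this(2) obtain \<theta> where "\<And>k. previous_lcm \<theta> k \<ge> 1 \<Longrightarrow> k \<ge> 1 \<Longrightarrow>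
      \<theta> k \<in> E\<^sub>1 \<and> \<not> sine_gen (\<theta> k) dvd previous_lcm \<theta> k \<and> \<eta>\<^sub>1 (\<theta> k) \<le> previous_lcm \<theta> k"
    by (rule greedy_sequence_exists[where
          P = "\<lambda>k \<theta>. \<theta> \<in> E\<^sub>1 \<and> \<not> sine_gen \<theta> dvd k \<and> \<eta>\<^sub>1 \<theta> \<le> k"]) blast+
  then have \<theta>: "\<theta> k \<in> E\<^sub>1" "\<not> sine_gen (\<theta> k) dvd previous_lcm \<theta> k"
      "\<eta>\<^sub>1 (\<theta> k) \<le> previous_lcm \<theta> k"
    if "previous_lcm \<theta> k \<ge> 1" "k \<ge> 1" for k
    using that by blast+
  have le: "angle_le (\<theta> ` K, \<eta>) (E\<^sub>1, \<eta>\<^sub>1)"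
    if "0 \<notin> K" "\<And>k. k \<in> K \<Longrightarrow> previous_lcm \<theta> k \<ge> 1"
      "\<And>k. k \<in> K \<Longrightarrow> \<eta> (\<theta> k) = previous_lcm \<theta> k" for K \<eta>
  proof -
    have "k \<ge> 1" if "k \<in> K" for k
      using \<open>0 \<notin> K\<close> that by (cases k) auto
    then show ?thesis using that \<theta> unfolding angle_le_def by auto
  qed
  show ?thesis
  proof (cases "\<forall>k\<ge>1. \<exists>r\<in>\<rat>. \<theta> k = r * pi")
    case True
    then have pos: "previous_lcm \<theta> k \<ge> 1" for k
      by (intro previous_lcm_pos) blast
    have unbounded: "\<exists>k\<in>{1..}. \<not> previous_lcm \<theta> (Suc k) dvd m" if "m \<ge> 1" for m
    proof -
      \<comment> \<open>The lcm of the first \<open>m\<close> generators already exceeds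
        \<open>m\<close>, so it cannot divide \<open>m\<close>.\<close>
      have "previous_lcm \<theta> (Suc m) \<ge> Suc m"
        using True \<theta>(2)[OF pos] by (intro previous_lcm_ge) blast+
      then have "\<not> previous_lcm \<theta> (Suc m) dvd m" using that by (auto dest: dvd_imp_le)
      then show ?thesis using that by auto
    qed
    obtain \<eta> where adm: "(\<theta> ` {1..}, \<eta>) \<in> admissible_angle_functions"
      and \<eta>: "\<And>k. k \<in> {1..} \<Longrightarrow> \<eta> (\<theta> k) = previous_lcm \<theta> k"
    proof (rule greedy_admissible)
      show "\<theta> k \<in> {0<..<pi}" if "k \<in> {1..}" for k
        using \<theta>(1)[OF pos] E1 that by blast
      show "\<not> sine_gen (\<theta> k) dvd previous_lcm \<theta> k" if "k \<in> {1..}" for k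
        using \<theta>(2)[OF pos] that by blast
    qed (use pos unbounded in auto)
    have "infinite_construction (\<theta> ` {1..}) \<eta>"
      unfolding infinite_construction_def previous_lcm_def[symmetric]
    proof (intro exI[of _ \<theta>] conjI allI impI)
      fix k :: nat
      assume "k \<ge> 1"
      then show "\<theta> k \<in> {0<..<pi}" "\<exists>r\<in>\<rat>. \<theta> k = r * pi"
        using \<theta>(1)[OF pos] E1 True by blast+
    next
      fix k :: nat
      assume "k \<ge> 2"
      then show "\<not> sine_gen (\<theta> k) dvd previous_lcm \<theta> k" "\<eta> (\<theta> k) = previous_lcm \<theta> k"
        using \<theta>(2)[OF pos] \<eta> by simp_all
    next
      show "\<eta> (\<theta> 1) = 1" using \<eta>[of 1] by simp
    qed (rule refl)
    then have "(\<theta> ` {1..}, \<eta>) \<in> basic_angle_functions"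
      using adm by (simp add: basic_angle_functions_def)
    moreover have "angle_le (\<theta> ` {1..}, \<eta>) (E\<^sub>1, \<eta>\<^sub>1)"
      using pos \<eta> by (intro le) auto
    ultimately show ?thesis by blast
  next
    case False
    define irr where "irr k \<longleftrightarrow> k \<ge> 1 \<and> \<not> (\<exists>r\<in>\<rat>. \<theta> k = r * pi)" for k
    \<comment> \<open>The first irrational angle ends the finite sequence. Since \<open>irr\<close>
      excludes index 0, \<open>N\<close> has the form \<open>n + 1\<close>; \<open>n = 0\<close> is
      the case without rational angles.\<close>
    define N where "N = (LEAST k. irr k)"
    have "irr N"
      unfolding N_def by (rule LeastI_ex) (use False in \<open>auto simp: irr_def\<close>)
    moreover have "\<not> irr k" if "k < N" for k
      using that not_less_Least unfolding N_def by blast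
    ultimately obtain n where n: "irr (n + 1)"
      and rat: "\<And>k. 1 \<le> k \<Longrightarrow> k < n + 1 \<Longrightarrow> \<exists>r\<in>\<rat>. \<theta> k = r * pi"
      by (cases N) (auto simp: irr_def)
    have pos: "previous_lcm \<theta> k \<ge> 1" if "k \<in> {1..n + 1}" for k
      using that by (intro previous_lcm_pos rat) auto
    \<comment> \<open>The greedy properties hold up to and including \<open>n + 1\<close>, because
      the lcm there involves rational angles only.\<close>
    note \<theta>' = \<theta>[OF pos]
    have unbounded: "\<exists>k\<in>{1..n + 1}. \<not> previous_lcm \<theta> (Suc k) dvd m" if "m \<ge> 1" for m
    proof -
      have "sine_gen (\<theta> (n + 1)) = 0"
        using n unfolding irr_def sine_gen_eq_0_iff by blast
      \<comment> \<open>The generator 0 of the irrational angle annihilates the lcm, and 0 divides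
        no positive \<open>m\<close>.\<close>
      then have "previous_lcm \<theta> (Suc (n + 1)) = 0" by (simp add: previous_lcm_Suc)
      then show ?thesis using that by (intro bexI[of _ "n + 1"]) auto
    qed
    obtain \<eta> where adm: "(\<theta> ` {1..n + 1}, \<eta>) \<in> admissible_angle_functions"
      and \<eta>: "\<And>k. k \<in> {1..n + 1} \<Longrightarrow> \<eta> (\<theta> k) = previous_lcm \<theta> k"
    proof (rule greedy_admissible)
      show "\<theta> k \<in> {0<..<pi}" "\<not> sine_gen (\<theta> k) dvd previous_lcm \<theta> k"
        if "k \<in> {1..n + 1}" for k
        using \<theta>'[OF that] E1 that by auto
    qed (use pos unbounded in auto)
    have "finite_construction (\<theta> ` {1..n + 1}) \<eta>"
      unfolding finite_construction_def previous_lcm_def[symmetric]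
    proof (intro exI[of _ n] exI[of _ \<theta>] conjI ballI)
      show "\<theta> k \<in> {0<..<pi}" "\<exists>r\<in>\<rat>. \<theta> k = r * pi" if "k \<in> {1..n}" for k
        using that \<theta>'(1)[of k] E1 rat[of k] by auto
      show "\<not> sine_gen (\<theta> k) dvd previous_lcm \<theta> k" if "k \<in> {2..n}" for k
        using that \<theta>'(2)[of k] by auto
      show "\<theta> (n + 1) \<in> {0<..<pi}" using \<theta>'(1)[of "n + 1"] E1 by auto
      show "\<not> (\<exists>r\<in>\<rat>. \<theta> (n + 1) = r * pi)" using n unfolding irr_def by blast
      show "\<eta> (\<theta> 1) = 1" using \<eta>[of 1] by simp
      show "\<eta> (\<theta> k) = previous_lcm \<theta> k" if "k \<in> {2..n + 1}" for k
        using that \<eta>[of k] by auto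
    qed (rule refl)
    then have "(\<theta> ` {1..n + 1}, \<eta>) \<in> basic_angle_functions"
      using adm by (simp add: basic_angle_functions_def)
    moreover have "angle_le (\<theta> ` {1..n + 1}, \<eta>) (E\<^sub>1, \<eta>\<^sub>1)"
      using pos \<eta> by (intro le) auto
    ultimately show ?thesis by blast
  qed
qed

end
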